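(* Let $\Gamma$ be a (discrete) group, let $S \subseteq \Gamma$ be a subset and let $C > 0$. Assume that for every $a \in \mathbb{C}\Gamma$ with $\operatorname{supp} a \subseteq S$ we have $\|a\|_{\mathrm{C}^*_{\mathrm{red}}(\Gamma)} \leq C \|a\|_2$. Then for every 2-cocycle $\sigma \in \mathrm{Z}^2(\Gamma, \mathrm{S}^1)$ and every $a \in \mathbb{C}\Gamma$ with $\operatorname{supp} a \subseteq S$ we have $\|a\|_{\mathrm{C}^*_{\mathrm{red}}(\Gamma, \sigma)} \leq C \|a\|_2$.
   Context: $\mathbb{C}\Gamma$ denotes the vector space of finitely supported functions $\Gamma \to \mathbb{C}$, with elements written as $a = \sum_g a_g u_g$; $\operatorname{supp} a = \{g \in \Gamma : a_g \neq 0\}$ and $\|a\|_2 = (\sum_g |a_g|^2)^{1/2}$. $\mathrm{S}^1$ denotes the unit circle in $\mathbb{C}$, and $\mathrm{Z}^2(\Gamma, \mathrm{S}^1)$ denotes the set of 2-cocycles for the trivial action, i.e. maps $\sigma \colon \Gamma \times \Gamma \to \mathrm{S}^1$ with $\sigma(g,h)\sigma(gh,k) = \sigma(h,k)\sigma(g,hk)$ for all $g,h,k \in \Gamma$. The twisted group algebra $\mathbb{C}(\Gamma,\sigma)$ is identified with $\mathbb{C}\Gamma$ as a vector space and carries the twisted convolution product $(a *_\sigma b)_g = \sum_{xy = g} \sigma(x,y) a_x b_y$. For $a \in \mathbb{C}\Gamma$, the norm $\|a\|_{\mathrm{C}^*_{\mathrm{red}}(\Gamma,\sigma)}$ is the operator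 norm on $\ell^2(\Gamma)$ of the bounded operator $\sum_g a_g \lambda_\sigma(g)$, where $\lambda_\sigma(g)\delta_h = \sigma(g,h)\delta_{gh}$ (that is, the operator extending $b \mapsto a *_\sigma b$). The norm $\|a\|_{\mathrm{C}^*_{\mathrm{red}}(\Gamma)}$ is the same norm for the trivial cocycle $\sigma \equiv 1$, i.e. the operator norm of left convolution by $a$ on $\ell^2(\Gamma)$. *)

theory Defs
  imports "HOL-Analysis.Analysis" "HOL-Algebra.Group"
begin

text \<open>
  Functions on a group \<open>G\<close> are total functions vanishing outside \<open>carrier G\<close>.
\<close>

definition supp :: "('a, 'b) monoid_scheme \<Rightarrow> ('a \<Rightarrow> complex) \<Rightarrow> 'a set" where
  "supp G a = {g \<in> carrier G. a g \<noteq> 0}"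

definition group_algebra :: "('a, 'b) monoid_scheme \<Rightarrow> ('a \<Rightarrow> complex) set" where
  "group_algebra G =
    {a. (\<forall>g. g \<notin> carrier G \<longrightarrow> a g = 0) \<and> finite (supp G a)}"

definition ell2 :: "('a, 'b) monoid_scheme \<Rightarrow> ('a \<Rightarrow> complex) set" where
  "ell2 G =
    {f. (\<forall>g. g \<notin> carrier G \<longrightarrow> f g = 0) \<and> (\<lambda>g. (cmod (f g))\<^sup>2) summable_on carrier G}"

definition norm2 :: "('a, 'b) monoid_scheme \<Rightarrow> ('a \<Rightarrow> complex) \<Rightarrow> real" where
  "norm2 G f = sqrt (\<Sum>\<^sub>\<infinity>g\<in>carrier G. (cmod (f g))\<^sup>2)"

text \<open>Only the values of a cocycle on \<open>carrier G\<close> are constrained, and only these are used.\<close>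

definition cocycles2 :: "('a, 'b) monoid_scheme \<Rightarrow> ('a \<Rightarrow> 'a \<Rightarrow> complex) set" where
  "cocycles2 G =
    {\<sigma>. (\<forall>g\<in>carrier G. \<forall>h\<in>carrier G. \<sigma> g h \<in> sphere 0 1) \<and>
        (\<forall>g\<in>carrier G. \<forall>h\<in>carrier G. \<forall>k\<in>carrier G.
           \<sigma> g h * \<sigma> (g \<otimes>\<^bsub>G\<^esub> h) k = \<sigma> h k * \<sigma> g (h \<otimes>\<^bsub>G\<^esub> k))}"

definition delta :: "'a \<Rightarrow> 'a \<Rightarrow> complex" where
  "delta h = (\<lambda>x. if x = h then 1 else 0)"

text \<open>
  The operator sending \<open>delta h\<close> to \<open>\<sigma> g h\<close> times \<open>delta (g \<otimes> h)\<close>, written pointwise so that it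
  acts on arbitrary functions; see \<open>twisted_shift_delta\<close> below.
\<close>

definition twisted_shift ::
    "('a, 'b) monoid_scheme \<Rightarrow> ('a \<Rightarrow> 'a \<Rightarrow> complex) \<Rightarrow> 'a \<Rightarrow> ('a \<Rightarrow> complex) \<Rightarrow> 'a \<Rightarrow> complex" where
  "twisted_shift G \<sigma> g f =
    (\<lambda>x. if x \<in> carrier G
         then \<sigma> g (inv\<^bsub>G\<^esub> g \<otimes>\<^bsub>G\<^esub> x) * f (inv\<^bsub>G\<^esub> g \<otimes>\<^bsub>G\<^esub> x) else 0)"

definition twisted_op ::
    "('a, 'b) monoid_scheme \<Rightarrow> ('a \<Rightarrow> 'a \<Rightarrow> complex) \<Rightarrow> ('a \<Rightarrow> complex)
      \<Rightarrow> ('a \<Rightarrow> complex) \<Rightarrow> 'a \<Rightarrow> complex" where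
  "twisted_op G \<sigma> a f = (\<lambda>x. \<Sum>g\<in>supp G a. a g * twisted_shift G \<sigma> g f x)"

text \<open>
  The supremum is taken in \<open>real\<close>; it is over a nonempty bounded set by
  \<open>red_norm_nonempty\<close> and \<open>red_norm_bdd_above\<close> below.
\<close>

definition red_norm ::
    "('a, 'b) monoid_scheme \<Rightarrow> ('a \<Rightarrow> 'a \<Rightarrow> complex) \<Rightarrow> ('a \<Rightarrow> complex) \<Rightarrow> real" where
  "red_norm G \<sigma> a = (SUP f\<in>{f \<in> ell2 G. norm2 G f \<le> 1}. norm2 G (twisted_op G \<sigma> a f))"

definition trivial_cocycle :: "'a \<Rightarrow> 'a \<Rightarrow> complex" where
  "trivial_cocycle = (\<lambda>_ _. 1)"

definition twisted_conv ::
    "('a, 'b) monoid_scheme \<Rightarrow> ('a \<Rightarrow> 'a \<Rightarrow> complex) \<Rightarrow> ('a \<Rightarrow> complex)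
      \<Rightarrow> ('a \<Rightarrow> complex) \<Rightarrow> 'a \<Rightarrow> complex" where
  "twisted_conv G \<sigma> a b =
    (\<lambda>g. \<Sum>(x, y)\<in>{(x, y) \<in> supp G a \<times> supp G b. x \<otimes>\<^bsub>G\<^esub> y = g}. \<sigma> x y * a x * b y)"

lemma trivial_cocycle_cocycle: "trivial_cocycle \<in> cocycles2 G"
  by (simp add: trivial_cocycle_def cocycles2_def)

lemma norm2_group_algebra:
  assumes "a \<in> group_algebra G"
  shows "norm2 G a = sqrt (\<Sum>g\<in>supp G a. (cmod (a g))\<^sup>2)"
proof -
  have "(\<Sum>\<^sub>\<infinity>g\<in>carrier G. (cmod (a g))\<^sup>2) = (\<Sum>\<^sub>\<infinity>g\<in>supp G a. (cmod (a g))\<^sup>2)"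
    by (rule infsum_cong_neutral) (auto simp: supp_def)
  then show ?thesis
    using assms by (simp add: norm2_def group_algebra_def supp_def)
qed

lemma twisted_shift_delta:
  assumes "group G" "g \<in> carrier G" "h \<in> carrier G"
  shows "twisted_shift G \<sigma> g (delta h) = (\<lambda>x. \<sigma> g h * delta (g \<otimes>\<^bsub>G\<^esub> h) x)"
proof -
  interpret group G by fact
  have "inv\<^bsub>G\<^esub> g \<otimes>\<^bsub>G\<^esub> x = h \<longleftrightarrow> x = g \<otimes>\<^bsub>G\<^esub> h" if "x \<in> carrier G" for x
    using that assms inv_solve_left' by (metis inv_solve_left)
  moreover have "\<sigma> g (inv\<^bsub>G\<^esub> g \<otimes>\<^bsub>G\<^esub> (g \<otimes>\<^bsub>G\<^esub> h)) = \<sigma> g h"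
    using assms by (simp add: m_assoc [symmetric])
  ultimately show ?thesis
    using assms by (auto simp: twisted_shift_def delta_def fun_eq_iff)
qed

lemma twisted_op_conv:
  assumes "group G" "a \<in> group_algebra G" "b \<in> group_algebra G"
  shows "twisted_op G \<sigma> a b = twisted_conv G \<sigma> a b"
proof
  interpret group G by fact
  fix z
  let ?P = "{(x, y) \<in> supp G a \<times> supp G b. x \<otimes>\<^bsub>G\<^esub> y = z}"
  have fin: "finite (supp G a)" and b0: "\<And>g. g \<notin> carrier G \<Longrightarrow> b g = 0"
    using assms by (auto simp: group_algebra_def supp_def)
  show "twisted_op G \<sigma> a b z = twisted_conv G \<sigma> a b z"
  proof (cases "z \<in> carrier G")
    case False
    then have "?P = {}" by (auto simp: supp_def)
    then have "twisted_conv G \<sigma> a b z = 0" by (simp only: twisted_conv_def sum.empty)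
    with False show ?thesis by (simp add: twisted_op_def twisted_shift_def)
  next
    case True
    let ?A = "{x \<in> supp G a. b (inv\<^bsub>G\<^esub> x \<otimes>\<^bsub>G\<^esub> z) \<noteq> 0}"
    have P: "?P = (\<lambda>x. (x, inv\<^bsub>G\<^esub> x \<otimes>\<^bsub>G\<^esub> z)) ` ?A"
      using True by (auto simp: supp_def image_iff m_assoc [symmetric])
    have inj: "inj_on (\<lambda>x. (x, inv\<^bsub>G\<^esub> x \<otimes>\<^bsub>G\<^esub> z)) ?A"
      by (auto simp: inj_on_def)
    have "twisted_conv G \<sigma> a b z =
        (\<Sum>x\<in>?A. \<sigma> x (inv\<^bsub>G\<^esub> x \<otimes>\<^bsub>G\<^esub> z) * a x * b (inv\<^bsub>G\<^esub> x \<otimes>\<^bsub>G\<^esub> z))"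
      unfolding twisted_conv_def P by (subst sum.reindex [OF inj]) simp
    also have "\<dots> = (\<Sum>x\<in>supp G a. \<sigma> x (inv\<^bsub>G\<^esub> x \<otimes>\<^bsub>G\<^esub> z) * a x * b (inv\<^bsub>G\<^esub> x \<otimes>\<^bsub>G\<^esub> z))"
      by (rule sum.mono_neutral_left) (use fin in auto)
    also have "\<dots> = twisted_op G \<sigma> a b z"
      using True by (simp add: twisted_op_def twisted_shift_def mult_ac)
    finally show ?thesis ..
  qed
qed

lemma ell2_shift:
  assumes "group G" "g \<in> carrier G" "f \<in> ell2 G"
  shows "(\<lambda>x. (cmod (f (inv\<^bsub>G\<^esub> g \<otimes>\<^bsub>G\<^esub> x)))\<^sup>2) summable_on carrier G"
    and "(\<Sum>\<^sub>\<infinity>x\<in>carrier G. (cmod (f (inv\<^bsub>G\<^esub> g \<otimes>\<^bsub>G\<^esub> x)))\<^sup>2) = (\<Sum>\<^sub>\<infinity>x\<in>carrier G. (cmod (f x))\<^sup>2)"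
proof -
  interpret group G by fact
  have bij: "bij_betw (\<lambda>x. inv\<^bsub>G\<^esub> g \<otimes>\<^bsub>G\<^esub> x) (carrier G) (carrier G)"
    by (rule bij_betwI [where g = "\<lambda>x. g \<otimes>\<^bsub>G\<^esub> x"]) (use assms in \<open>auto simp: m_assoc [symmetric]\<close>)
  show "(\<lambda>x. (cmod (f (inv\<^bsub>G\<^esub> g \<otimes>\<^bsub>G\<^esub> x)))\<^sup>2) summable_on carrier G"
    using summable_on_reindex_bij_betw [OF bij, of "\<lambda>x. (cmod (f x))\<^sup>2"] assms(3)
    by (simp add: ell2_def)
  show "(\<Sum>\<^sub>\<infinity>x\<in>carrier G. (cmod (f (inv\<^bsub>G\<^esub> g \<otimes>\<^bsub>G\<^esub> x)))\<^sup>2) = (\<Sum>\<^sub>\<infinity>x\<in>carrier G. (cmod (f x))\<^sup>2)"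
    using infsum_reindex_bij_betw [OF bij, of "\<lambda>x. (cmod (f x))\<^sup>2"] by simp
qed

lemma has_sum_sum_finite:
  fixes s :: "'i \<Rightarrow> 'a \<Rightarrow> real"
  assumes "finite I" "\<And>i. i \<in> I \<Longrightarrow> (s i has_sum t i) A"
  shows "((\<lambda>x. \<Sum>i\<in>I. s i x) has_sum (\<Sum>i\<in>I. t i)) A"
  using assms by (induction I rule: finite_induct) (auto intro!: has_sum_add)

lemma twisted_op_bounded:
  assumes "group G" "\<sigma> \<in> cocycles2 G" "a \<in> group_algebra G" "f \<in> ell2 G"
  shows "twisted_op G \<sigma> a f \<in> ell2 G"
    and "norm2 G (twisted_op G \<sigma> a f) \<le> sqrt (card (supp G a)) * norm2 G a * norm2 G f"
proof -
  interpret group G by fact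
  let ?T = "twisted_op G \<sigma> a f" and ?A = "supp G a"
  let ?s = "\<lambda>g x. (cmod (f (inv\<^bsub>G\<^esub> g \<otimes>\<^bsub>G\<^esub> x)))\<^sup>2"
  let ?N = "\<Sum>g\<in>?A. (cmod (a g))\<^sup>2"
  have A: "?A \<subseteq> carrier G" "finite ?A"
    using assms by (auto simp: group_algebra_def supp_def)
  have ptw: "(cmod (?T x))\<^sup>2 \<le> ?N * (\<Sum>g\<in>?A. ?s g x)" if x: "x \<in> carrier G" for x
  proof -
    have "cmod (?T x) \<le> (\<Sum>g\<in>?A. cmod (a g) * cmod (f (inv\<^bsub>G\<^esub> g \<otimes>\<^bsub>G\<^esub> x)))"
      unfolding twisted_op_def
    proof (rule sum_norm_le)
      fix g assume "g \<in> ?A"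
      with A have "g \<in> carrier G" by auto
      with x assms(2) have "cmod (\<sigma> g (inv\<^bsub>G\<^esub> g \<otimes>\<^bsub>G\<^esub> x)) = 1"
        by (auto simp: cocycles2_def)
      then show "cmod (a g * twisted_shift G \<sigma> g f x) \<le> cmod (a g) * cmod (f (inv\<^bsub>G\<^esub> g \<otimes>\<^bsub>G\<^esub> x))"
        using x by (simp add: twisted_shift_def norm_mult)
    qed
    then have "(cmod (?T x))\<^sup>2 \<le> (\<Sum>g\<in>?A. cmod (a g) * cmod (f (inv\<^bsub>G\<^esub> g \<otimes>\<^bsub>G\<^esub> x)))\<^sup>2"
      by (rule power_mono) simp
    also have "\<dots> \<le> ?N * (\<Sum>g\<in>?A. ?s g x)"
      by (rule Cauchy_Schwarz_ineq_sum)
    finally show ?thesis .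
  qed
  have hs: "((\<lambda>x. \<Sum>g\<in>?A. ?s g x) has_sum (\<Sum>g\<in>?A. \<Sum>\<^sub>\<infinity>x\<in>carrier G. (cmod (f x))\<^sup>2)) (carrier G)"
  proof (rule has_sum_sum_finite [OF A(2)])
    fix g assume "g \<in> ?A"
    with A have "g \<in> carrier G" by auto
    from has_sum_infsum [OF ell2_shift(1) [OF assms(1) this assms(4)]]
    show "(?s g has_sum (\<Sum>\<^sub>\<infinity>x\<in>carrier G. (cmod (f x))\<^sup>2)) (carrier G)"
      by (simp only: ell2_shift(2) [OF assms(1) \<open>g \<in> carrier G\<close> assms(4)])
  qed
  then have sum: "(\<lambda>x. \<Sum>g\<in>?A. ?s g x) summable_on carrier G"
    by (rule has_sum_imp_summable)
  then have sum': "(\<lambda>x. ?N * (\<Sum>g\<in>?A. ?s g x)) summable_on carrier G"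
    by (rule summable_on_cmult_right)
  have sumT: "(\<lambda>x. (cmod (?T x))\<^sup>2) summable_on carrier G"
    by (rule summable_on_comparison_test [OF sum']) (use ptw in auto)
  then show "?T \<in> ell2 G"
    by (auto simp: ell2_def twisted_op_def twisted_shift_def)
  have "(\<Sum>\<^sub>\<infinity>x\<in>carrier G. (cmod (?T x))\<^sup>2) \<le> (\<Sum>\<^sub>\<infinity>x\<in>carrier G. ?N * (\<Sum>g\<in>?A. ?s g x))"
    by (rule infsum_mono [OF sumT sum' ptw])
  also have "\<dots> = ?N * (\<Sum>\<^sub>\<infinity>x\<in>carrier G. \<Sum>g\<in>?A. ?s g x)"
    by (rule infsum_cmult_right) (use sum in auto)
  also have "(\<Sum>\<^sub>\<infinity>x\<in>carrier G. \<Sum>g\<in>?A. ?s g x) = (\<Sum>g\<in>?A. \<Sum>\<^sub>\<infinity>x\<in>carrier G. (cmod (f x))\<^sup>2)"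
    by (rule infsumI [OF hs])
  finally have "norm2 G ?T \<le> sqrt (?N * (card ?A * (\<Sum>\<^sub>\<infinity>x\<in>carrier G. (cmod (f x))\<^sup>2)))"
    by (simp add: norm2_def)
  then show "norm2 G ?T \<le> sqrt (card ?A) * norm2 G a * norm2 G f"
    unfolding norm2_group_algebra [OF assms(3)] norm2_def [of G f]
    by (simp add: real_sqrt_mult mult_ac)
qed

lemma red_norm_nonempty: "{f \<in> ell2 G. norm2 G f \<le> 1} \<noteq> {}"
proof -
  have "(\<lambda>_. 0) \<in> {f \<in> ell2 G. norm2 G f \<le> 1}"
    by (simp add: ell2_def norm2_def)
  then show ?thesis by blast
qed

lemma red_norm_bdd_above:
  assumes "group G" "\<sigma> \<in> cocycles2 G" "a \<in> group_algebra G"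
  shows "bdd_above ((\<lambda>f. norm2 G (twisted_op G \<sigma> a f)) ` {f \<in> ell2 G. norm2 G f \<le> 1})"
proof (rule bdd_aboveI2)
  fix f assume f: "f \<in> {f \<in> ell2 G. norm2 G f \<le> 1}"
  have "norm2 G (twisted_op G \<sigma> a f) \<le> sqrt (card (supp G a)) * norm2 G a * norm2 G f"
    using twisted_op_bounded(2) [OF assms] f by simp
  also have "\<dots> \<le> sqrt (card (supp G a)) * norm2 G a"
    using f by (intro mult_left_le) (auto simp: norm2_def infsum_nonneg)
  finally show "norm2 G (twisted_op G \<sigma> a f) \<le> sqrt (card (supp G a)) * norm2 G a" .
qed

end

theory Submission
  imports Defs
begin

text \<open>
  Pointwise \<open>\<bar>a *\<^sub>\<sigma> f\<bar> \<le> \<bar>a\<bar> * \<bar>f\<bar>\<close>, since \<open>\<sigma>\<close> takes values in the unit circle. Passing to absolute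
  values changes neither supports nor 2-norms, so the bound for \<open>\<bar>a\<bar>\<close> in the untwisted algebra
  gives the bound for \<open>a\<close> in the twisted one.
\<close>

text \<open>Complex-valued, so that \<open>cabs a\<close> is again an element of the group algebra
  and the hypothesis on \<open>S\<close> can be applied to it.\<close>

definition cabs :: "('a \<Rightarrow> complex) \<Rightarrow> 'a \<Rightarrow> complex" where
  "cabs f = (\<lambda>x. complex_of_real (cmod (f x)))"

lemma supp_cabs [simp]: "supp G (cabs a) = supp G a"
  by (simp add: supp_def cabs_def)

lemma norm2_cabs [simp]: "norm2 G (cabs f) = norm2 G f"
  by (simp add: norm2_def cabs_def)

lemma cabs_group_algebra [simp]: "cabs a \<in> group_algebra G \<longleftrightarrow> a \<in> group_algebra G"
  by (simp add: group_algebra_def) (simp add: cabs_def)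

lemma cabs_ell2 [simp]: "cabs f \<in> ell2 G \<longleftrightarrow> f \<in> ell2 G"
  by (simp add: ell2_def cabs_def)

text \<open>Square-summability of \<open>h\<close> matters: the infinite sum of a non-summable
  family is 0 by default, which would break the comparison.\<close>

lemma norm2_mono:
  assumes "f \<in> ell2 G" "h \<in> ell2 G"
    and "\<And>x. x \<in> carrier G \<Longrightarrow> cmod (f x) \<le> cmod (h x)"
  shows "norm2 G f \<le> norm2 G h"
  unfolding norm2_def
  using assms by (auto intro!: infsum_mono power_mono simp: ell2_def)

lemma cmod_twisted_op_le:
  assumes "group G" "\<sigma> \<in> cocycles2 G" "x \<in> carrier G"
  shows "cmod (twisted_op G \<sigma> a f x) \<le> cmod (twisted_op G trivial_cocycle (cabs a) (cabs f) x)"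
proof -
  interpret group G by fact
  let ?r = "\<lambda>g. cmod (a g) * cmod (f (inv\<^bsub>G\<^esub> g \<otimes>\<^bsub>G\<^esub> x))"
  have "cmod (twisted_op G \<sigma> a f x) \<le> (\<Sum>g\<in>supp G a. ?r g)"
    unfolding twisted_op_def
  proof (rule sum_norm_le)
    fix g assume "g \<in> supp G a"
    then have "g \<in> carrier G" by (simp add: supp_def)
    with assms have "cmod (\<sigma> g (inv\<^bsub>G\<^esub> g \<otimes>\<^bsub>G\<^esub> x)) = 1"
      by (auto simp: cocycles2_def)
    then show "cmod (a g * twisted_shift G \<sigma> g f x) \<le> ?r g"
      using assms by (simp add: twisted_shift_def norm_mult)
  qed
  \<comment> \<open>All terms are nonnegative reals, so nothing cancels and the untwisted value
    equals the triangle-inequality majorant.\<close>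
  moreover have "twisted_op G trivial_cocycle (cabs a) (cabs f) x = of_real (\<Sum>g\<in>supp G a. ?r g)"
    using assms(3) by (simp add: twisted_op_def twisted_shift_def trivial_cocycle_def)
      (simp add: cabs_def)
  then have "cmod (twisted_op G trivial_cocycle (cabs a) (cabs f) x) = (\<Sum>g\<in>supp G a. ?r g)"
    by (simp only: norm_of_real) (simp add: sum_nonneg)
  ultimately show ?thesis by simp
qed

text \<open>\<open>cabs\<close> maps the unit ball of \<open>ell2 G\<close> into itself, so each
  value in the twisted supremum is dominated by one in the untwisted supremum.\<close>

lemma red_norm_le_trivial:
  assumes "group G" "\<sigma> \<in> cocycles2 G" "a \<in> group_algebra G"
  shows "red_norm G \<sigma> a \<le> red_norm G trivial_cocycle (cabs a)"
  unfolding red_norm_def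
proof (rule cSUP_mono [OF red_norm_nonempty])
  \<comment> \<open>A supremum in \<open>real\<close> is an upper bound only for a bounded set, so
    the dominating side must be bounded.\<close>
  show "bdd_above ((\<lambda>f. norm2 G (twisted_op G trivial_cocycle (cabs a) f)) `
      {f \<in> ell2 G. norm2 G f \<le> 1})"
    by (rule red_norm_bdd_above) (use assms trivial_cocycle_cocycle in auto)
next
  fix f assume f: "f \<in> {f \<in> ell2 G. norm2 G f \<le> 1}"
  have "norm2 G (twisted_op G \<sigma> a f) \<le> norm2 G (twisted_op G trivial_cocycle (cabs a) (cabs f))"
    by (intro norm2_mono twisted_op_bounded(1) cmod_twisted_op_le)
      (use assms f trivial_cocycle_cocycle in auto)
  then show "\<exists>h\<in>{f \<in> ell2 G. norm2 G f \<le> 1}.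
      norm2 G (twisted_op G \<sigma> a f) \<le> norm2 G (twisted_op G trivial_cocycle (cabs a) h)"
    using f by (intro bexI [of _ "cabs f"]) auto
qed

theorem proposition2:
  fixes G :: "('a, 'b) monoid_scheme" and S :: "'a set" and C :: real
  assumes "group G" and "S \<subseteq> carrier G" and "C > 0"
    and "\<And>a. a \<in> group_algebra G \<Longrightarrow> supp G a \<subseteq> S \<Longrightarrow> red_norm G trivial_cocycle a \<le> C * norm2 G a"
  shows "\<forall>\<sigma> \<in> cocycles2 G. \<forall>a \<in> group_algebra G. supp G a \<subseteq> S \<longrightarrow> red_norm G \<sigma> a \<le> C * norm2 G a"
proof (intro ballI impI)
  fix \<sigma> a assume "\<sigma> \<in> cocycles2 G" "a \<in> group_algebra G" "supp G a \<subseteq> S"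
  \<comment> \<open>The hypothesis is applied to \<open>cabs a\<close>, whose support also lies in
    \<open>S\<close>.\<close>
  then show "red_norm G \<sigma> a \<le> C * norm2 G a"
    using red_norm_le_trivial [OF assms(1), of \<sigma> a] assms(4) [of "cabs a"] by simp
qed

end
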